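(* Let $\alpha>1$ and consider the function $\mathcal{H}_\alpha(y)=-(1-y^2)^\alpha$ on $[-1,1]$. Then, for each $\mathcal{F}\in\mathfrak{C}^1([-1,1])$: \begin{itemize} \item[1.] If $\mathcal{F}\sim_1\mathcal{H}_\alpha$, the $\mathcal{F}$-catenoids $\{\Sigma_{\mathcal{F}}(r)\}_{r>0}$ all have unbounded upper height. \item[2.] If $\mathcal{F}\sim_{-1}\mathcal{H}_\alpha$, the $\mathcal{F}$-catenoids $\{\Sigma_{\mathcal{F}}(r)\}_{r>0}$ all have unbounded lower height. \item[3.] If $\mathcal{F}\sim\mathcal{H}_\alpha$, the $\mathcal{F}$-catenoids $\{\Sigma_{\mathcal{F}}(r)\}_{r>0}$ all have both unbounded upper height and unbounded lower height. \end{itemize}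
   Context: $\mathfrak{C}^1([-1,1]):=\{\mathcal{H}\in C^1([-1,1]):\ \mathcal{H}(y)<0\ \text{for all } y\in(-1,1),\ \mathcal{H}(-1)=\mathcal{H}(1)=0\}$. For $\mathcal{H}\in\mathfrak{C}^1([-1,1])$, an $\mathcal{H}$-surface is an immersed oriented surface $\Sigma\subset\mathbb{R}^3$ with unit normal $\eta$ whose mean curvature (half the sum of principal curvatures) is $H_\Sigma=\mathcal{H}(\langle\eta,e_3\rangle)$, $e_3=(0,0,1)$. For every $r_0>0$ the $\mathcal{H}$-catenoid $\Sigma_{\mathcal{H}}(r_0)$ is the (known to exist and unique) properly embedded annular $\mathcal{H}$-surface, rotationally symmetric about the $z$-axis, which is a bi-graph over the exterior of the disk $D(0,r_0)$ in $\{z=0\}$, meeting $\{z=0\}$ orthogonally along its waist, the circle of radius $r_0$ (its necksize); its unit normal points inwards at the waist, upwards on the upper end $\Sigma_{\mathcal{H}}^+(r_0)=\Sigma_{\mathcal{H}}(r_0)\cap\{z\ge0\}$ and downwards on the lower end $\Sigma_{\mathcal{H}}^-(r_0)=\Sigma_{\mathcal{H}}(r_0)\cap\{z\le0\}$. The upper and lower ends are obtained by rotating about the $z$-axis the graphs $z=f_+(x)$ and $z=f_-(x)$, $x>r_0$, where $f_+$ (upper height) and $f_-$ (lower height) satisfy $$2\mathcal{H}\Big(\tfrac{1}{\sqrt{1+f_+'^2}}\Big)=\frac{f_+''}{(1+f_+'^2)^{3/2}}+\frac{f_+'}{x\sqrt{1+f_+'^2}},\qquad -2\mathcal{H}\Big(\tfrac{-1}{\sqrt{1+f_-'^2}}\Big)=\frac{f_-''}{(1+f_-'^2)^{3/2}}+\frac{f_-'}{x\sqrt{1+f_-'^2}},$$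 with $f_\pm(x)\to0$ and $f_\pm'(x)\to\pm\infty$ as $x\to r_0^+$. $\Sigma_{\mathcal{H}}(r_0)$ has unbounded (bounded) upper height if $f_+$ is unbounded (bounded) on $(r_0,\infty)$, and unbounded (bounded) lower height if $f_-$ is unbounded (bounded). For $\mathcal{H},\mathcal{F}\in\mathfrak{C}^1([-1,1])$: $\mathcal{H}\sim_1\mathcal{F}$ means $\lim_{y\to1}\mathcal{H}(y)/\mathcal{F}(y)=C_1$ for some nonzero constant $C_1$; $\mathcal{H}\sim_{-1}\mathcal{F}$ means $\lim_{y\to-1}\mathcal{H}(y)/\mathcal{F}(y)=C_2$ for some nonzero constant $C_2$; $\mathcal{H}\sim\mathcal{F}$ means both. *)

theory Defs
  imports "HOL-Analysis.Analysis"
begin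

section \<open>Prescribed functions\<close>

definition frakC1 :: "(real \<Rightarrow> real) set" where
  "frakC1 = {H. (\<exists>H'. (\<forall>y\<in>{-1..1}. (H has_real_derivative H' y) (at y within {-1..1})) \<and>
                     continuous_on {-1..1} H') \<and>
                (\<forall>y\<in>{-1<..<1}. H y < 0) \<and> H (-1) = 0 \<and> H 1 = 0}"

definition sim_at_1 :: "(real \<Rightarrow> real) \<Rightarrow> (real \<Rightarrow> real) \<Rightarrow> bool" where
  "sim_at_1 H F \<longleftrightarrow> (\<exists>C. C \<noteq> 0 \<and> ((\<lambda>y. H y / F y) \<longlongrightarrow> C) (at_left 1))"

definition sim_at_m1 :: "(real \<Rightarrow> real) \<Rightarrow> (real \<Rightarrow> real) \<Rightarrow> bool" where
  "sim_at_m1 H F \<longleftrightarrow> (\<exists>C. C \<noteq> 0 \<and> ((\<lambda>y. H y / F y) \<longlongrightarrow> C) (at_right (-1)))"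

definition sim_both :: "(real \<Rightarrow> real) \<Rightarrow> (real \<Rightarrow> real) \<Rightarrow> bool" where
  "sim_both H F \<longleftrightarrow> sim_at_1 H F \<and> sim_at_m1 H F"

definition H_alpha :: "real \<Rightarrow> real \<Rightarrow> real" where
  "H_alpha \<alpha> y = - ((1 - y\<^sup>2) powr \<alpha>)"


section \<open>Regular surfaces and mean curvature\<close>

definition C2_on :: "'a::real_normed_vector set \<Rightarrow> ('a \<Rightarrow> 'b::real_normed_vector) \<Rightarrow> bool" where
  "C2_on U f \<longleftrightarrow> (\<exists>(f' :: 'a \<Rightarrow> 'a \<Rightarrow>\<^sub>L 'b) (f'' :: 'a \<Rightarrow> 'a \<Rightarrow>\<^sub>L ('a \<Rightarrow>\<^sub>L 'b)).
     (\<forall>q\<in>U. (f has_derivative blinfun_apply (f' q)) (at q)) \<and>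
     (\<forall>q\<in>U. (f' has_derivative blinfun_apply (f'' q)) (at q)) \<and>
     continuous_on U f'')"

text \<open>Regular local parametrizations \<^term>\<open>X\<close> of an embedded surface \<^term>\<open>\<Sigma>\<close>: an immersion
  that is a homeomorphism onto a relatively open part of \<^term>\<open>\<Sigma>\<close>.\<close>

definition local_parametrization ::
    "(real^3) set \<Rightarrow> (real \<times> real) set \<Rightarrow> (real \<times> real \<Rightarrow> real^3) \<Rightarrow> bool" where
  "local_parametrization \<Sigma> U X \<longleftrightarrow>
     open U \<and> C2_on U X \<and> (\<forall>q\<in>U. inj (frechet_derivative X (at q))) \<and>
     openin (top_of_set \<Sigma>) (X ` U) \<and> (\<exists>Y. homeomorphism U (X ` U) X Y)"

definition regular_surface :: "(real^3) set \<Rightarrow> bool" where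
  "regular_surface \<Sigma> \<longleftrightarrow> (\<forall>p\<in>\<Sigma>. \<exists>U X. local_parametrization \<Sigma> U X \<and> p \<in> X ` U)"

definition unit_normal :: "(real^3) set \<Rightarrow> (real^3 \<Rightarrow> real^3) \<Rightarrow> bool" where
  "unit_normal \<Sigma> \<eta> \<longleftrightarrow> continuous_on \<Sigma> \<eta> \<and> (\<forall>p\<in>\<Sigma>. norm (\<eta> p) = 1) \<and>
     (\<forall>U X. local_parametrization \<Sigma> U X \<longrightarrow>
        (\<forall>q\<in>U. \<forall>w. \<eta> (X q) \<bullet> frechet_derivative X (at q) w = 0))"

definition first_form :: "(real \<times> real \<Rightarrow> real^3) \<Rightarrow> real \<times> real \<Rightarrow>
    real \<times> real \<Rightarrow> real \<times> real \<Rightarrow> real" where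
  "first_form X q v w = frechet_derivative X (at q) v \<bullet> frechet_derivative X (at q) w"

definition second_form :: "(real \<times> real \<Rightarrow> real^3) \<Rightarrow> real^3 \<Rightarrow> real \<times> real \<Rightarrow>
    real \<times> real \<Rightarrow> real \<times> real \<Rightarrow> real" where
  "second_form X N q v w =
     frechet_derivative (\<lambda>s. frechet_derivative X (at s) v) (at q) w \<bullet> N"

text \<open>The principal curvatures are the eigenvalues of the shape operator, counted with
  multiplicity, i.e. the roots of \<open>det (II - k I) = det I \<cdot> (k - k1) (k - k2)\<close>, where \<open>I\<close> and
  \<open>II\<close> are the matrices of the two fundamental forms in the coordinate basis.\<close>

definition principal_curvatures :: "(real \<times> real \<Rightarrow> real^3) \<Rightarrow> real^3 \<Rightarrow> real \<times> real \<Rightarrow>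
    real \<Rightarrow> real \<Rightarrow> bool" where
  "principal_curvatures X N q k1 k2 \<longleftrightarrow>
    (let u = (1, 0); v = (0, 1); I = first_form X q; II = second_form X N q in
      \<forall>k. (II u u - k * I u u) * (II v v - k * I v v) - (II u v - k * I u v)\<^sup>2 =
          (I u u * I v v - (I u v)\<^sup>2) * ((k - k1) * (k - k2)))"

definition has_mean_curvature :: "(real \<times> real \<Rightarrow> real^3) \<Rightarrow> real^3 \<Rightarrow> real \<times> real \<Rightarrow>
    real \<Rightarrow> bool" where
  "has_mean_curvature X N q h \<longleftrightarrow>
     (\<exists>k1 k2. principal_curvatures X N q k1 k2 \<and> h = (k1 + k2) / 2)"

definition e3 :: "real^3" where
  "e3 = axis 3 1"

text \<open>Mean curvature does not depend on the parametrization (only on \<^term>\<open>\<eta>\<close>), so the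
  prescribed mean curvature equation is imposed in every local parametrization.\<close>

definition embedded_H_surface ::
    "(real \<Rightarrow> real) \<Rightarrow> (real^3) set \<Rightarrow> (real^3 \<Rightarrow> real^3) \<Rightarrow> bool" where
  "embedded_H_surface H \<Sigma> \<eta> \<longleftrightarrow> regular_surface \<Sigma> \<and> unit_normal \<Sigma> \<eta> \<and>
     (\<forall>U X. local_parametrization \<Sigma> U X \<longrightarrow>
        (\<forall>q\<in>U. has_mean_curvature X (\<eta> (X q)) q (H (\<eta> (X q) \<bullet> e3))))"


section \<open>Catenoids\<close>

definition rot_z :: "real \<Rightarrow> real^3 \<Rightarrow> real^3" where
  "rot_z \<theta> p = vector [cos \<theta> * p $ 1 - sin \<theta> * p $ 2, sin \<theta> * p $ 1 + cos \<theta> * p $ 2, p $ 3]"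

definition rotationally_symmetric :: "(real^3) set \<Rightarrow> bool" where
  "rotationally_symmetric \<Sigma> \<longleftrightarrow> (\<forall>\<theta>. rot_z \<theta> ` \<Sigma> = \<Sigma>)"

definition annular :: "(real^3) set \<Rightarrow> bool" where
  "annular \<Sigma> \<longleftrightarrow> \<Sigma> homeomorphic (sphere (0::real \<times> real) 1 \<times> (UNIV::real set))"

definition graph_over :: "(real \<times> real) set \<Rightarrow> (real \<times> real \<Rightarrow> real) \<Rightarrow> (real^3) set" where
  "graph_over S u = {vector [x, y, u (x, y)] |x y. (x, y) \<in> S}"

definition upper_part :: "(real^3) set \<Rightarrow> (real^3) set" where
  "upper_part \<Sigma> = {p\<in>\<Sigma>. p $ 3 \<ge> 0}"

definition lower_part :: "(real^3) set \<Rightarrow> (real^3) set" where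
  "lower_part \<Sigma> = {p\<in>\<Sigma>. p $ 3 \<le> 0}"

definition waist :: "real \<Rightarrow> (real^3) set" where
  "waist r = {p. (p $ 1)\<^sup>2 + (p $ 2)\<^sup>2 = r\<^sup>2 \<and> p $ 3 = 0}"

text \<open>The norm on \<^typ>\<open>real \<times> real\<close> is Euclidean. The graphing functions are only continuous,
  not differentiable, at the boundary circle, where the surface is vertical.\<close>

definition bigraph_over_exterior :: "real \<Rightarrow> (real^3) set \<Rightarrow> bool" where
  "bigraph_over_exterior r \<Sigma> \<longleftrightarrow> (\<exists>u v.
     C2_on {q. norm q > r} u \<and> C2_on {q. norm q > r} v \<and>
     continuous_on {q. norm q \<ge> r} u \<and> continuous_on {q. norm q \<ge> r} v \<and>
     (\<forall>q. norm q = r \<longrightarrow> u q = 0 \<and> v q = 0) \<and>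
     (\<forall>q. norm q > r \<longrightarrow> u q > 0 \<and> v q < 0) \<and>
     upper_part \<Sigma> = graph_over {q. norm q \<ge> r} u \<and>
     lower_part \<Sigma> = graph_over {q. norm q \<ge> r} v)"

text \<open>Properness of the embedding amounts to \<^term>\<open>\<Sigma>\<close> being closed. The inward unit normal
  \<open>- p / r\<close> along the waist also says that \<^term>\<open>\<Sigma>\<close> is orthogonal to the plane \<open>z = 0\<close> there.\<close>

definition H_catenoid :: "(real \<Rightarrow> real) \<Rightarrow> real \<Rightarrow> (real^3) set \<Rightarrow> bool" where
  "H_catenoid H r \<Sigma> \<longleftrightarrow> (\<exists>\<eta>. embedded_H_surface H \<Sigma> \<eta> \<and> closed \<Sigma> \<and> annular \<Sigma> \<and>
     rotationally_symmetric \<Sigma> \<and> bigraph_over_exterior r \<Sigma> \<and>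
     (\<forall>p\<in>waist r. \<eta> p = - (p /\<^sub>R r)) \<and>
     (\<forall>p\<in>upper_part \<Sigma> - waist r. \<eta> p \<bullet> e3 > 0) \<and>
     (\<forall>p\<in>lower_part \<Sigma> - waist r. \<eta> p \<bullet> e3 < 0))"

text \<open>The functions \<open>f\<^sub>+\<close> and \<open>f\<^sub>-\<close> whose graphs over \<open>x > r\<close> generate the two ends.\<close>

definition upper_height :: "(real^3) set \<Rightarrow> real \<Rightarrow> real" where
  "upper_height \<Sigma> x = (THE z. vector [x, 0, z] \<in> upper_part \<Sigma>)"

definition lower_height :: "(real^3) set \<Rightarrow> real \<Rightarrow> real" where
  "lower_height \<Sigma> x = (THE z. vector [x, 0, z] \<in> lower_part \<Sigma>)"

definition unbounded_upper_height :: "real \<Rightarrow> (real^3) set \<Rightarrow> bool" where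
  "unbounded_upper_height r \<Sigma> \<longleftrightarrow> \<not> bounded (upper_height \<Sigma> ` {r<..})"

definition unbounded_lower_height :: "real \<Rightarrow> (real^3) set \<Rightarrow> bool" where
  "unbounded_lower_height r \<Sigma> \<longleftrightarrow> \<not> bounded (lower_height \<Sigma> ` {r<..})"

end

theory Submission
  imports Defs
begin

text \<open>
  Let \<open>z = u(x, y)\<close> be one end of the catenoid and let \<open>\<sigma>\<close> be \<open>1\<close> for the upper and \<open>-1\<close> for the
  lower end, so that \<open>f(x) = \<sigma> u(x, 0)\<close> is positive. With \<open>W = sqrt (1 + f'\<^sup>2)\<close>, the prescribed mean
  curvature equation in the graph chart together with rotational symmetry gives the profile equation
  \<open>2 F(\<sigma> / W) = f'' / W\<^sup>3 + f' / (x W)\<close> (\<open>rotational_graph_profile\<close>), which treats both ends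
  alike.

  In terms of the sine \<open>\<phi> = f' / W\<close> of the tilt angle it reads \<open>(x \<phi>)' = 2 x F(\<sigma> / W)\<close>, and
  \<open>1 - 1 / W\<^sup>2 = \<phi>\<^sup>2\<close>. Comparability of \<open>F\<close> with \<open>-(1 - y\<^sup>2)\<^sup>\<alpha>\<close> near the pole, and compactness away from
  it, yield \<open>\<bar>F(\<sigma> y)\<bar> \<le> K (1 - y\<^sup>2)\<^sup>\<alpha>\<close> on \<open>[0, 1]\<close> (\<open>bound_by_H_alpha\<close>). Since \<open>F \<le> 0\<close>, \<open>w = x \<phi>\<close> is
  nonincreasing, and by this bound, as long as it is nonnegative, \<open>w' \<ge> - 2 K x\<^sup>1\<^sup>-\<^sup>2\<^sup>\<alpha> w\<^sup>2\<^sup>\<alpha> \<ge> - k x\<^sup>1\<^sup>-\<^sup>2\<^sup>\<alpha> w\<close>. The rate \<open>x\<^sup>1\<^sup>-\<^sup>2\<^sup>\<alpha>\<close> is integrable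
  at infinity exactly because \<open>\<alpha> > 1\<close>, so \<open>w\<close> stays above a positive constant \<open>c\<close>
  (\<open>sublinear_decay_bounded_below\<close>). Therefore \<open>f' \<ge> \<phi> \<ge> c / x\<close>, and \<open>f\<close> grows at least
  logarithmically (\<open>profile_log_growth\<close>).

  The comparison needs a starting point where \<open>f' > 0\<close>. The mean value theorem provides one, because
  \<open>f\<close> vanishes on the waist and is positive beyond it.
\<close>

section \<open>Graphs in space\<close>

definition graph_map :: "(real \<times> real \<Rightarrow> real) \<Rightarrow> real \<times> real \<Rightarrow> real^3" where
  "graph_map u q = vector [fst q, snd q, u q]"

lemma vector_3_axes:
  "(vector [a, b, c] :: real^3) = a *\<^sub>R axis 1 1 + b *\<^sub>R axis 2 1 + c *\<^sub>R axis 3 1"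
  by (simp add: vec_eq_iff forall_3 axis_def)

lemma inner_vector_3:
  "(vector [a, b, c] :: real^3) \<bullet> vector [a', b', c'] = a * a' + b * b' + c * c'"
  by (simp add: inner_vec_def sum_3)

lemma inner_e3: "p \<bullet> e3 = p $ 3"
  by (simp add: e3_def inner_axis)

lemma graph_map_eq_iff [simp]: "graph_map u p = graph_map v q \<longleftrightarrow> p = q \<and> u p = v q"
  by (auto simp: graph_map_def vec_eq_iff forall_3 prod_eq_iff)

lemma graph_map_nth [simp]:
  "graph_map u q $ 1 = fst q" "graph_map u q $ 2 = snd q" "graph_map u q $ 3 = u q"
  by (simp_all add: graph_map_def)

lemma graph_over_eq_image: "graph_over S u = graph_map u ` S"
  by (force simp: graph_over_def graph_map_def)

lemma has_derivative_graph_map: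
  assumes "(u has_derivative u') (at q)"
  shows "(graph_map u has_derivative (\<lambda>v. vector [fst v, snd v, u' v])) (at q)"
  unfolding graph_map_def vector_3_axes
  by (auto intro!: derivative_eq_intros assms)

lemma frechet_derivative_graph_map:
  assumes "(u has_derivative u') (at q)"
  shows "frechet_derivative (graph_map u) (at q) = (\<lambda>v. vector [fst v, snd v, u' v])"
  using frechet_derivative_at[OF has_derivative_graph_map[OF assms]] by simp

lemma frechet_derivative_frechet_derivative_graph_map:
  fixes u' :: "real \<times> real \<Rightarrow> (real \<times> real) \<Rightarrow>\<^sub>L real"
  assumes "open U" "q \<in> U"
    and d1: "\<And>q. q \<in> U \<Longrightarrow> (u has_derivative u' q) (at q)"
    and d2: "(u' has_derivative blinfun_apply u'') (at q)"
  shows "frechet_derivative (\<lambda>s. frechet_derivative (graph_map u) (at s) v) (at q) w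
           = vector [0, 0, u'' w v]"
proof -
  have "((\<lambda>s. vector [fst v, snd v, u' s v] :: real^3) has_derivative
          (\<lambda>w. vector [0, 0, u'' w v])) (at q)"
    unfolding vector_3_axes
    by (auto intro!: derivative_eq_intros d2)
  then have "((\<lambda>s. frechet_derivative (graph_map u) (at s) v) has_derivative
          (\<lambda>w. vector [0, 0, u'' w v])) (at q)"
    by (rule has_derivative_transform_within_open[OF _ assms(1,2)])
       (simp add: frechet_derivative_graph_map[OF d1])
  from frechet_derivative_at[OF this] show ?thesis
    by (metis)
qed

text \<open>The first derivative of \<open>graph_map u\<close> is a constant plus the image of that of \<open>u\<close> under the bounded
  linear operator of composition with \<open>t \<mapsto> (0, 0, t)\<close>; so regularity is inherited from \<open>u\<close>.\<close>

lemma C2_on_graph_map: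
  assumes "C2_on U u"
  shows "C2_on U (graph_map u)"
proof -
  obtain u' :: "real \<times> real \<Rightarrow> (real \<times> real) \<Rightarrow>\<^sub>L real" and u'' where
    d1: "\<And>q. q \<in> U \<Longrightarrow> (u has_derivative u' q) (at q)" and
    d2: "\<And>q. q \<in> U \<Longrightarrow> (u' has_derivative blinfun_apply (u'' q)) (at q)" and
    cont: "continuous_on U u''"
    using assms unfolding C2_on_def by blast
  define B :: "real \<Rightarrow>\<^sub>L (real^3)" where "B = blinfun_scaleR_left (axis 3 1)"
  define P :: "(real \<times> real) \<Rightarrow>\<^sub>L (real^3)" where
    "P = Blinfun (\<lambda>v. fst v *\<^sub>R axis 1 1 + snd v *\<^sub>R axis 2 1)"
  have P: "blinfun_apply P v = fst v *\<^sub>R axis 1 1 + snd v *\<^sub>R axis 2 1" for v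
    unfolding P_def by (subst bounded_linear_Blinfun_apply) (auto intro!: bounded_linear_intros)
  define C :: "((real \<times> real) \<Rightarrow>\<^sub>L real) \<Rightarrow>\<^sub>L ((real \<times> real) \<Rightarrow>\<^sub>L (real^3))" where
    "C = Blinfun (\<lambda>L. B o\<^sub>L L)"
  have C: "blinfun_apply C L = B o\<^sub>L L" for L
    unfolding C_def by (subst bounded_linear_Blinfun_apply) (auto intro!: bounded_linear_intros)
  have "(graph_map u has_derivative blinfun_apply (P + C (u' q))) (at q)" if "q \<in> U" for q
    using has_derivative_graph_map[OF d1[OF that]]
    by (rule has_derivative_eq_rhs)
       (auto simp: fun_eq_iff plus_blinfun.rep_eq P C B_def vector_3_axes)
  moreover have "((\<lambda>q. P + C (u' q)) has_derivative blinfun_apply (C o\<^sub>L u'' q)) (at q)"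
    if "q \<in> U" for q
    by (auto intro!: derivative_eq_intros d2[OF that])
  moreover have "continuous_on U (\<lambda>q. C o\<^sub>L u'' q)"
    by (intro continuous_intros cont)
  ultimately show ?thesis
    unfolding C2_on_def
    by (intro exI[of _ "\<lambda>q. P + C (u' q)"] exI[of _ "\<lambda>q. C o\<^sub>L u'' q"]) simp
qed

lemma local_parametrization_graph_map:
  assumes "open U" "C2_on U u" and op: "openin (top_of_set \<Sigma>) (graph_map u ` U)"
  shows "local_parametrization \<Sigma> U (graph_map u)"
proof -
  obtain u' :: "real \<times> real \<Rightarrow> (real \<times> real) \<Rightarrow>\<^sub>L real" where
    d1: "\<And>q. q \<in> U \<Longrightarrow> (u has_derivative u' q) (at q)"
    using assms unfolding C2_on_def by blast
  have "inj (frechet_derivative (graph_map u) (at q))" if "q \<in> U" for q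
    unfolding frechet_derivative_graph_map[OF d1[OF that]]
    by (auto simp: inj_on_def vec_eq_iff forall_3 prod_eq_iff)
  moreover have "continuous_on U (graph_map u)"
    using has_derivative_graph_map[OF d1]
    by (meson continuous_at_imp_continuous_on has_derivative_continuous)
  then have "homeomorphism U (graph_map u ` U) (graph_map u) (\<lambda>p. (p $ 1, p $ 2))"
    by (auto simp: homeomorphism_def image_image intro!: continuous_intros)
  ultimately show ?thesis
    unfolding local_parametrization_def using assms C2_on_graph_map by blast
qed

text \<open>At a point where \<open>u\<^sub>y = 0\<close> the first fundamental form is diagonal, so twice the mean curvature is
  the sum of the normal curvatures in the two coordinate directions. The number \<open>\<sigma>\<close> is the sign of the vertical
  component of the normal; it turns the formula for the upward normal into one for both orientations.\<close>

lemma mean_curvature_graph_map: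
  fixes u' :: "real \<times> real \<Rightarrow> (real \<times> real) \<Rightarrow>\<^sub>L real" and N :: "real^3"
  assumes "open U" "q \<in> U"
    and d1: "\<And>q. q \<in> U \<Longrightarrow> (u has_derivative u' q) (at q)"
    and d2: "(u' has_derivative blinfun_apply u'') (at q)"
    and crit: "u' q (0, 1) = 0"
    and N: "norm N = 1" "\<And>w. N \<bullet> frechet_derivative (graph_map u) (at q) w = 0"
    and \<sigma>: "\<bar>\<sigma>\<bar> = 1" "\<sigma> * (N \<bullet> e3) > 0"
    and h: "has_mean_curvature (graph_map u) N q h"
  defines "W \<equiv> sqrt (1 + (u' q (1, 0))\<^sup>2)"
  shows "N \<bullet> e3 = \<sigma> / W"
    and "2 * h = \<sigma> * (u'' (1, 0) (1, 0) / W ^ 3 + u'' (0, 1) (0, 1) / W)"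
proof -
  define a where "a = u' q (1, 0)"
  have W: "W > 0" "W\<^sup>2 = 1 + a\<^sup>2"
    by (auto simp: W_def a_def add_pos_nonneg)
  have N_inner: "N \<bullet> vector [x, y, z] = N $ 1 * x + N $ 2 * y + N $ 3 * z" for x y z
    by (simp add: inner_vec_def sum_3)
  have orth: "N $ 1 * fst w + N $ 2 * snd w + N $ 3 * u' q w = 0" for w
    using N(2)[of w] unfolding frechet_derivative_graph_map[OF d1[OF \<open>q \<in> U\<close>]] N_inner .
  have n1: "N $ 1 = - a * N $ 3"
    using orth[of "(1, 0)"] by (simp add: a_def algebra_simps)
  have n2: "N $ 2 = 0"
    using orth[of "(0, 1)"] crit by simp
  have "N \<bullet> N = 1"
    using N(1) by (simp add: norm_eq_1)
  then have "(N $ 3)\<^sup>2 * (1 + a\<^sup>2) = 1"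
    by (simp add: inner_vec_def sum_3 n1 n2 power2_eq_square algebra_simps)
  then have "(N $ 3)\<^sup>2 * W\<^sup>2 = 1"
    by (simp only: W)
  moreover have "\<sigma>\<^sup>2 = 1"
    using \<sigma>(1) by (metis power2_abs power_one)
  ultimately have "(\<sigma> * N $ 3 * W)\<^sup>2 = 1"
    by (simp add: power_mult_distrib)
  moreover have "\<sigma> * N $ 3 * W > 0"
    using \<sigma>(2) W by (simp add: inner_e3)
  ultimately have "\<sigma> * N $ 3 * W = 1"
    by (simp add: power2_eq_1_iff)
  then have "\<sigma> * (\<sigma> * N $ 3 * W) = \<sigma>"
    by simp
  then have "\<sigma>\<^sup>2 * N $ 3 * W = \<sigma>"
    by (simp add: power2_eq_square mult.assoc)
  then have n3: "N $ 3 = \<sigma> / W"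
    using W \<open>\<sigma>\<^sup>2 = 1\<close> by (simp add: field_simps)
  then show "N \<bullet> e3 = \<sigma> / W"
    by (simp add: inner_e3)
  have II: "second_form (graph_map u) N q v w = u'' w v * N $ 3" for v w
    using frechet_derivative_frechet_derivative_graph_map[OF assms(1,2) d1 d2]
    by (simp add: second_form_def inner_commute[of _ N] N_inner)
  have I: "first_form (graph_map u) q v w = fst v * fst w + snd v * snd w + u' q v * u' q w" for v w
    unfolding first_form_def frechet_derivative_graph_map[OF d1[OF \<open>q \<in> U\<close>]] inner_vector_3 ..
  obtain k1 k2 where k: "principal_curvatures (graph_map u) N q k1 k2" and hk: "h = (k1 + k2) / 2"
    using h unfolding has_mean_curvature_def by blast
  define A B M where "A = u'' (1, 0) (1, 0)" and "B = u'' (0, 1) (0, 1)" and "M = u'' (0, 1) (1, 0)"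
  have k': "(A * N $ 3 - k * W\<^sup>2) * (B * N $ 3 - k) - (M * N $ 3)\<^sup>2 = W\<^sup>2 * ((k - k1) * (k - k2))" for k
    using k unfolding principal_curvatures_def Let_def W(2)
    by (simp add: I II A_def B_def M_def crit power2_eq_square flip: a_def)
  \<comment> \<open>The coefficient of \<open>k\<close> carries the sum of the roots; a difference of two values extracts it.\<close>
  have "W\<^sup>2 * (2 * h) = N $ 3 * (A + W\<^sup>2 * B)"
    using k'[of 1] k'[of "-1"] unfolding hk by (simp add: algebra_simps)
  then show "2 * h = \<sigma> * (u'' (1, 0) (1, 0) / W ^ 3 + u'' (0, 1) (0, 1) / W)"
    using W(1) unfolding n3 by (simp add: field_simps power2_eq_square power3_eq_cube A_def B_def)
qed

section \<open>The profile equation of a rotational end\<close>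

text \<open>Rotational invariance expresses the \<open>y\<close>-derivatives of \<open>u\<close> on the positive \<open>x\<close>-axis through the
  profile: since \<open>- y u\<^sub>x + x u\<^sub>y = 0\<close> everywhere, \<open>u\<^sub>y\<close> vanishes there, and differentiating the
  identity once more in \<open>y\<close> gives \<open>x u\<^sub>y\<^sub>y = u\<^sub>x\<close>.\<close>

lemma rotational_graph_profile:
  assumes "C2_on {q. norm q > r} u" "r > 0"
    and rot: "\<And>\<theta> x y. norm (x, y) > r \<Longrightarrow>
      u (cos \<theta> * x - sin \<theta> * y, sin \<theta> * x + cos \<theta> * y) = u (x, y)"
    and N: "\<And>q. norm q > r \<Longrightarrow> norm (N q) = 1"
      "\<And>q w. norm q > r \<Longrightarrow> N q \<bullet> frechet_derivative (graph_map u) (at q) w = 0"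
    and \<sigma>: "\<bar>\<sigma>\<bar> = 1" "\<And>q. norm q > r \<Longrightarrow> \<sigma> * (N q \<bullet> e3) > 0"
    and h: "\<And>q. norm q > r \<Longrightarrow> has_mean_curvature (graph_map u) (N q) q (F (N q \<bullet> e3))"
  obtains p p' where
    "\<And>x. x > r \<Longrightarrow> ((\<lambda>x. u (x, 0)) has_real_derivative p x) (at x)"
    "\<And>x. x > r \<Longrightarrow> (p has_real_derivative p' x) (at x)"
    "\<And>x. x > r \<Longrightarrow> 2 * F (\<sigma> / sqrt (1 + (p x)\<^sup>2)) =
        \<sigma> * (p' x / sqrt (1 + (p x)\<^sup>2) ^ 3 + p x / x / sqrt (1 + (p x)\<^sup>2))"
proof -
  define U :: "(real \<times> real) set" where "U = {q. norm q > r}"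
  have "open U"
    unfolding U_def by (intro open_Collect_less continuous_intros)
  obtain u' :: "real \<times> real \<Rightarrow> (real \<times> real) \<Rightarrow>\<^sub>L real" and u'' where
    d1: "\<And>q. q \<in> U \<Longrightarrow> (u has_derivative u' q) (at q)" and
    d2: "\<And>q. q \<in> U \<Longrightarrow> (u' has_derivative blinfun_apply (u'' q)) (at q)"
    using assms(1) unfolding C2_on_def U_def by blast
  have angular: "u' q (- snd q, fst q) = 0" if "q \<in> U" for q
  proof -
    define g where "g \<theta> = (cos \<theta> * fst q - sin \<theta> * snd q, sin \<theta> * fst q + cos \<theta> * snd q)" for \<theta> :: real
    have "(g has_derivative (\<lambda>t. t *\<^sub>R (- snd q, fst q))) (at 0)"
      unfolding g_def by (auto intro!: derivative_eq_intros)
    moreover have "g 0 = q"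
      by (simp add: g_def)
    ultimately have "((\<lambda>\<theta>. u (g \<theta>)) has_derivative (\<lambda>t. u' q (t *\<^sub>R (- snd q, fst q)))) (at 0)"
      using has_derivative_compose[of g _ 0 UNIV u "u' q"] d1[OF that] by simp
    moreover have "(\<lambda>\<theta>. u (g \<theta>)) = (\<lambda>_. u q)"
      using rot[of "fst q" "snd q"] that by (simp add: g_def U_def)
    ultimately have "(\<lambda>t. u' q (t *\<^sub>R (- snd q, fst q))) = (\<lambda>_. 0)"
      by (auto intro: has_derivative_unique)
    from fun_cong[OF this, of 1] show ?thesis
      by simp
  qed
  have angular2: "u'' q w (- snd q, fst q) + u' q (- snd w, fst w) = 0" if "q \<in> U" for q w
  proof -
    have 1: "((\<lambda>q. blinfun_apply (u' q) (- snd q, fst q)) has_derivative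
        (\<lambda>w. u' q (- snd w, fst w) + u'' q w (- snd q, fst q))) (at q)"
      by (rule bounded_bilinear.FDERIV[OF bounded_bilinear_blinfun_apply d2[OF that]])
         (auto intro!: derivative_eq_intros)
    have "((\<lambda>q. 0 :: real) has_derivative
        (\<lambda>w. u' q (- snd w, fst w) + u'' q w (- snd q, fst q))) (at q)"
      by (rule has_derivative_transform_within_open[OF 1 \<open>open U\<close> that]) (rule angular)
    from fun_cong[OF has_derivative_unique[OF this has_derivative_const], of w] show ?thesis
      by simp
  qed
  define p where "p x = u' (x, 0) (1, 0)" for x
  define p' where "p' x = u'' (x, 0) (1, 0) (1, 0)" for x
  have inU: "(x, 0) \<in> U" if "x > r" for x
    using that \<open>r > 0\<close> by (simp add: U_def norm_Pair)
  have line: "((\<lambda>x. (x, 0 :: real)) has_derivative (\<lambda>t. (t, 0))) (at x)" for x :: real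
    by (auto intro!: derivative_eq_intros)
  have pair: "blinfun_apply L (t, 0) = t *\<^sub>R blinfun_apply L (1, 0)"
    for L :: "(real \<times> real) \<Rightarrow>\<^sub>L 'c::real_normed_vector" and t
    by (simp flip: blinfun.scaleR_right)
  show thesis
  proof (rule that)
    fix x assume x: "x > r"
    show "((\<lambda>x. u (x, 0)) has_real_derivative p x) (at x)"
      using has_derivative_compose[OF line d1[OF inU[OF x]]]
      unfolding has_field_derivative_def p_def
      by (rule has_derivative_eq_rhs) (rule ext, subst pair, simp)
    have "((\<lambda>x. u' (x, 0)) has_derivative (\<lambda>t. u'' (x, 0) (t, 0))) (at x)"
      using has_derivative_compose[OF line d2[OF inU[OF x]]] .
    then have "((\<lambda>x. blinfun_apply (u' (x, 0)) (1, 0)) has_derivative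
        (\<lambda>t. u'' (x, 0) (t, 0) (1, 0))) (at x)"
      by (auto intro!: derivative_eq_intros)
    then show "(p has_real_derivative p' x) (at x)"
      unfolding has_field_derivative_def p_def p'_def
      by (rule has_derivative_eq_rhs) (rule ext, subst pair, simp add: blinfun.scaleR_left)
    have nrm: "norm (x, 0 :: real) > r"
      using inU[OF x] by (simp add: U_def)
    have crit: "u' (x, 0) (0, 1) = 0"
    proof -
      have "u' (x, 0) (x *\<^sub>R (0, 1)) = 0"
        using angular[OF inU[OF x]] by simp
      then show ?thesis
        unfolding blinfun.scaleR_right using x \<open>r > 0\<close> by simp
    qed
    have uyy: "u'' (x, 0) (0, 1) (0, 1) = p x / x"
    proof -
      have "u'' (x, 0) (0, 1) (x *\<^sub>R (0, 1)) + u' (x, 0) (- (1, 0)) = 0"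
        using angular2[OF inU[OF x], of "(0, 1)"] by simp
      then show ?thesis
        unfolding blinfun.scaleR_right blinfun.minus_right
        using x \<open>r > 0\<close> by (simp add: p_def field_simps)
    qed
    note mc = mean_curvature_graph_map[OF \<open>open U\<close> inU[OF x] d1 d2[OF inU[OF x]] crit
        N(1)[OF nrm] N(2)[OF nrm] \<sigma>(1) \<sigma>(2)[OF nrm] h[OF nrm]]
    show "2 * F (\<sigma> / sqrt (1 + (p x)\<^sup>2)) =
        \<sigma> * (p' x / sqrt (1 + (p x)\<^sup>2) ^ 3 + p x / x / sqrt (1 + (p x)\<^sup>2))"
      using mc uyy by (simp add: p_def p'_def)
  qed
qed

section \<open>Logarithmic growth of the profile\<close>

text \<open>Near \<open>1\<close> the limit controls the quotient of \<open>G\<close> and \<open>H_alpha\<close>; away from \<open>1\<close> the quotient is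
  continuous on a compact interval.\<close>

lemma bound_by_H_alpha:
  assumes cont: "continuous_on {0..1} G" and G1: "G 1 = 0"
    and lim: "((\<lambda>y. G y / H_alpha \<alpha> y) \<longlongrightarrow> C) (at_left 1)"
  obtains K where "K \<ge> 0" "\<And>y. y \<in> {0..1} \<Longrightarrow> \<bar>G y\<bar> \<le> K * (1 - y\<^sup>2) powr \<alpha>"
proof -
  have "eventually (\<lambda>y. dist (G y / H_alpha \<alpha> y) C < 1) (at_left 1)"
    using lim by (rule tendstoD) simp
  then obtain b where b: "b < 1" "\<And>y. b < y \<Longrightarrow> y < 1 \<Longrightarrow> dist (G y / H_alpha \<alpha> y) C < 1"
    unfolding eventually_at_left_field by blast
  define c where "c = max b 0"
  have c: "0 \<le> c" "c < 1" "b \<le> c"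
    using b(1) by (auto simp: c_def)
  have near: "\<bar>G y\<bar> \<le> (\<bar>C\<bar> + 1) * (1 - y\<^sup>2) powr \<alpha>" if "c < y" "y < 1" for y
  proof -
    have "y\<^sup>2 < 1"
      using that c by (simp add: power_less_one_iff abs_square_less_1)
    then have pos: "(1 - y\<^sup>2) powr \<alpha> > 0"
      by simp
    have "\<bar>G y / H_alpha \<alpha> y\<bar> \<le> \<bar>C\<bar> + 1"
      using b(2)[of y] that c by (auto simp: dist_real_def)
    then show ?thesis
      using pos by (simp add: H_alpha_def field_simps)
  qed
  have c2: "y\<^sup>2 < 1" if "y \<in> {0..c}" for y
    using that c by (simp add: abs_square_less_1)
  have "continuous_on {0..c} (\<lambda>y. G y / (1 - y\<^sup>2) powr \<alpha>)"
    using c2 c by (intro continuous_intros continuous_on_subset[OF cont]) fastforce+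
  then have "bounded ((\<lambda>y. G y / (1 - y\<^sup>2) powr \<alpha>) ` {0..c})"
    by (intro compact_imp_bounded compact_continuous_image) auto
  then obtain M where M: "\<And>y. y \<in> {0..c} \<Longrightarrow> \<bar>G y / (1 - y\<^sup>2) powr \<alpha>\<bar> \<le> M"
    unfolding bounded_real by blast
  have far: "\<bar>G y\<bar> \<le> M * (1 - y\<^sup>2) powr \<alpha>" if "y \<in> {0..c}" for y
    using M[OF that] c2[OF that] by (simp add: field_simps)
  show thesis
  proof (rule that)
    show "max (\<bar>C\<bar> + 1) M \<ge> 0" by simp
    fix y :: real assume "y \<in> {0..1}"
    then consider "y \<in> {0..c}" | "c < y" "y < 1" | "y = 1"
      by fastforce
    then show "\<bar>G y\<bar> \<le> max (\<bar>C\<bar> + 1) M * (1 - y\<^sup>2) powr \<alpha>"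
    proof cases
      case 1
      then show ?thesis
        using far by (meson max.cobounded2 mult_right_mono order_trans powr_ge_zero)
    next
      case 2
      then show ?thesis
        using near by (meson max.cobounded1 mult_right_mono order_trans powr_ge_zero)
    next
      case 3
      then show ?thesis by (simp add: G1)
    qed
  qed
qed

text \<open>Multiplying \<open>w\<close> by the integrating factor \<open>exp A\<close> makes it nondecreasing while it is nonnegative.
  The decay estimate is only available there, so the first zero of \<open>w\<close> has to be excluded before
  monotonicity can be used globally.\<close>

lemma sublinear_decay_bounded_below:
  fixes w :: "real \<Rightarrow> real"
  assumes der: "\<And>x. x \<ge> a \<Longrightarrow> (w has_real_derivative w' x) (at x)"
    and derA: "\<And>x. x \<ge> a \<Longrightarrow> (A has_real_derivative A' x) (at x)"
    and decay: "\<And>x. x \<ge> a \<Longrightarrow> w x \<ge> 0 \<Longrightarrow> w' x \<ge> - A' x * w x"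
    and "w a > 0" "x \<ge> a"
  shows "w x \<ge> w a * exp (A a - A x)"
proof -
  define h where "h x = w x * exp (A x)" for x
  have derh: "(h has_real_derivative (w' x + A' x * w x) * exp (A x)) (at x)" if "x \<ge> a" for x
    unfolding h_def by (auto intro!: derivative_eq_intros der derA that simp: algebra_simps)
  have mono: "h a \<le> h t" if "a \<le> t" "\<And>x. x \<in> {a..t} \<Longrightarrow> w x \<ge> 0" for t
    using that(1)
  proof (rule DERIV_nonneg_imp_nondecreasing)
    fix x assume "a \<le> x" "x \<le> t"
    then show "\<exists>y. (h has_real_derivative y) (at x) \<and> 0 \<le> y"
      using derh[of x] decay[of x] that(2)[of x] by (intro exI[of _ "(w' x + A' x * w x) * exp (A x)"]) auto
  qed
  have ha: "h a > 0"
    using \<open>w a > 0\<close> by (simp add: h_def)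
  have "w t > 0" if "t \<ge> a" for t
  proof (rule ccontr)
    assume neg: "\<not> w t > 0"
    define Z where "Z = {s \<in> {a..t}. w s = 0}"
    have cont: "continuous_on {a..t} w"
      using der by (meson DERIV_isCont atLeastAtMost_iff continuous_at_imp_continuous_on)
    then have "\<exists>s\<ge>a. s \<le> t \<and> w s = 0"
      using neg \<open>w a > 0\<close> that by (intro IVT2') auto
    then have "Z \<noteq> {}"
      by (auto simp: Z_def)
    moreover have "compact Z"
    proof -
      have "closed Z"
        unfolding Z_def by (rule continuous_closed_preimage_constant[OF cont]) simp
      then show ?thesis
        by (auto simp: compact_eq_bounded_closed Z_def intro: bounded_subset[of "{a..t}"])
    qed
  \<comment> \<open>The first zero \<open>s\<close> of \<open>w\<close>: the decay estimate holds on all of \<open>[a, s]\<close>.\<close>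
    ultimately obtain s where s: "s \<in> Z" "\<And>s'. s' \<in> Z \<Longrightarrow> s \<le> s'"
      by (meson compact_attains_inf)
    have "w x \<ge> 0" if x: "x \<in> {a..s}" for x
    proof (rule ccontr)
      assume "\<not> w x \<ge> 0"
      then have "\<exists>s'\<ge>a. s' \<le> x \<and> w s' = 0"
        using \<open>w a > 0\<close> x s(1) cont
        by (intro IVT2') (auto simp: Z_def elim: continuous_on_subset)
      then obtain s' where s': "a \<le> s'" "s' \<le> x" "w s' = 0" by blast
      then have "s \<le> s'"
        using s x by (intro s(2)) (auto simp: Z_def)
      then have "s' = x"
        using s' x by simp
      then show False
        using s' \<open>\<not> w x \<ge> 0\<close> by simp
    qed
    then have "h a \<le> h s"
      using s(1) by (intro mono) (auto simp: Z_def)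
    then show False
      using ha s(1) by (simp add: h_def Z_def)
  qed
  then have "h a \<le> h x"
    using \<open>x \<ge> a\<close> by (intro mono) (auto intro: less_imp_le)
  then show ?thesis
    by (simp add: h_def exp_diff field_simps)
qed

text \<open>If \<open>p\<close> is the slope of a plane curve, then \<open>p / sqrt (1 + p\<^sup>2)\<close> is the sine of its tilt angle, and its
  derivative is the curvature.\<close>

lemma has_real_derivative_sin_angle:
  assumes "(p has_real_derivative p') (at x)"
  shows "((\<lambda>x. p x / sqrt (1 + (p x)\<^sup>2)) has_real_derivative p' / sqrt (1 + (p x)\<^sup>2) ^ 3) (at x)"
proof -
  define s where "s = sqrt (1 + (p x)\<^sup>2)"
  have pos: "1 + (p x)\<^sup>2 > 0"
    by (simp add: add_pos_nonneg)
  then have s: "s > 0" "s\<^sup>2 = 1 + (p x)\<^sup>2"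
    by (auto simp: s_def)
  have "((\<lambda>x. p x / sqrt (1 + (p x)\<^sup>2)) has_real_derivative
      (p' * s - p x * (p x * p' / s)) / (s * s)) (at x)"
    using pos s
    by (auto intro!: derivative_eq_intros assms simp: s_def[symmetric] field_simps)
  moreover have "(p' * s - p x * (p x * p' / s)) / (s * s) = p' * (s\<^sup>2 - (p x)\<^sup>2) / s ^ 3"
    using s(1) by (simp add: field_simps power2_eq_square power3_eq_cube)
  ultimately show ?thesis
    by (simp add: s s_def[symmetric])
qed

text \<open>Here \<open>y\<close> and \<open>\<phi>\<close> are the cosine and sine of the tilt angle, and \<open>w = x \<phi>\<close> satisfies
  \<open>w' = 2 x G(y)\<close>. The bound on \<open>G\<close> is of order \<open>\<phi>\<^sup>2\<^sup>\<alpha>\<close>; since \<open>w\<close> is nonincreasing, all but one of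
  these powers of \<open>\<phi> = w / x\<close> can be estimated by powers of \<open>w a / x\<close>, which turns the inequality into
  a linear one with an integrable coefficient.\<close>

lemma profile_log_growth:
  assumes "\<alpha> > 1" "a > 0" "K \<ge> 0"
    and derf: "\<And>x. x \<ge> a \<Longrightarrow> (f has_real_derivative p x) (at x)"
    and derp: "\<And>x. x \<ge> a \<Longrightarrow> (p has_real_derivative p' x) (at x)"
    and "p a > 0"
    and ode: "\<And>x. x \<ge> a \<Longrightarrow>
      2 * G (1 / sqrt (1 + (p x)\<^sup>2)) = p' x / sqrt (1 + (p x)\<^sup>2) ^ 3 + p x / x / sqrt (1 + (p x)\<^sup>2)"
    and Gneg: "\<And>y. y \<in> {0<..1} \<Longrightarrow> G y \<le> 0"
    and Gbound: "\<And>y. y \<in> {0<..1} \<Longrightarrow> - G y \<le> K * (1 - y\<^sup>2) powr \<alpha>"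
  obtains c where "c > 0" "\<And>x. x \<ge> a \<Longrightarrow> f x \<ge> f a + c * ln (x / a)"
proof -
  define y where "y x = 1 / sqrt (1 + (p x)\<^sup>2)" for x
  define \<phi> where "\<phi> x = p x / sqrt (1 + (p x)\<^sup>2)" for x
  define w where "w x = x * \<phi> x" for x
  have sq: "1 + (p x)\<^sup>2 > 0" "sqrt (1 + (p x)\<^sup>2) \<ge> 1" for x
    by (auto simp: add_pos_nonneg)
  have y: "y x \<in> {0<..1}" for x
    using sq[of x] unfolding y_def by auto
  have y\<phi>: "1 - (y x)\<^sup>2 = (\<phi> x)\<^sup>2" for x
    using sq(1)[of x] by (simp add: y_def \<phi>_def power_divide field_simps)
  have der: "(w has_real_derivative 2 * x * G (y x)) (at x)" if "x \<ge> a" for x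
  proof -
    have "(w has_real_derivative \<phi> x + x * (p' x / sqrt (1 + (p x)\<^sup>2) ^ 3)) (at x)"
      unfolding w_def \<phi>_def
      by (rule derivative_eq_intros has_real_derivative_sin_angle derp that refl)+ simp
    moreover have "\<phi> x + x * (p' x / sqrt (1 + (p x)\<^sup>2) ^ 3) =
        x * (p' x / sqrt (1 + (p x)\<^sup>2) ^ 3 + p x / x / sqrt (1 + (p x)\<^sup>2))"
      using that \<open>a > 0\<close> by (simp add: \<phi>_def distrib_left)
    ultimately show ?thesis
      unfolding ode[OF that, symmetric] by (simp add: y_def mult_ac)
  qed
  have decr: "w x \<le> w a" if "x \<ge> a" for x
    using that
  proof (rule DERIV_nonpos_imp_nonincreasing)
    fix t assume "a \<le> t" "t \<le> x"
    then show "\<exists>d. (w has_real_derivative d) (at t) \<and> d \<le> 0"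
      using der[of t] Gneg[OF y[of t]] \<open>a > 0\<close>
      by (intro exI[of _ "2 * t * G (y t)"]) (auto simp: mult_nonneg_nonpos)
  qed
  have wa: "w a > 0"
    using \<open>p a > 0\<close> \<open>a > 0\<close> sq[of a] by (auto simp: w_def \<phi>_def)
  define k where "k = 2 * K * w a powr (2 * \<alpha> - 1)"
  \<comment> \<open>The antiderivative of the decay rate that tends to \<open>0\<close> at infinity; its values are at most \<open>0\<close>.\<close>
  define A where "A x = - k / (2 * \<alpha> - 2) * x powr (2 - 2 * \<alpha>)" for x
  have "k \<ge> 0"
    using \<open>K \<ge> 0\<close> by (simp add: k_def)
  have derA: "(A has_real_derivative k * x powr (1 - 2 * \<alpha>)) (at x)" if "x \<ge> a" for x
  proof -
    have "(A has_real_derivative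
        - k / (2 * \<alpha> - 2) * ((2 - 2 * \<alpha>) * x powr (2 - 2 * \<alpha> - 1))) (at x)"
      unfolding A_def using that \<open>a > 0\<close> by (intro DERIV_cmult has_real_derivative_powr) simp
    moreover have "- k / (2 * \<alpha> - 2) * (2 - 2 * \<alpha>) = k"
      using \<open>\<alpha> > 1\<close> by (simp add: field_simps)
    moreover have "2 - 2 * \<alpha> - 1 = 1 - 2 * \<alpha>"
      by simp
    ultimately show ?thesis
      by (metis mult.assoc)
  qed
  have decay: "2 * x * G (y x) \<ge> - (k * x powr (1 - 2 * \<alpha>)) * w x" if "x \<ge> a" "w x \<ge> 0" for x
  proof -
    have "x > 0" using that \<open>a > 0\<close> by simp
    then have \<phi>: "\<phi> x = w x / x" by (simp add: w_def)
    then have "\<phi> x \<ge> 0" using that \<open>x > 0\<close> by simp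
    have "((\<phi> x)\<^sup>2) powr \<alpha> = \<phi> x powr (2 * \<alpha>)"
      using \<open>\<phi> x \<ge> 0\<close> by (metis powr_numeral powr_powr mult.commute powr_0 zero_power2 powr_eq_0_iff order_le_less)
    also have "\<dots> = \<phi> x * \<phi> x powr (2 * \<alpha> - 1)"
      using \<open>\<phi> x \<ge> 0\<close> powr_mult_base[of "\<phi> x" "2 * \<alpha> - 1"] by simp
    also have "\<dots> \<le> \<phi> x * (w a / x) powr (2 * \<alpha> - 1)"
      using \<open>\<phi> x \<ge> 0\<close> \<open>x > 0\<close> \<open>\<alpha> > 1\<close> decr[OF that(1)] unfolding \<phi>
      by (intro mult_left_mono powr_mono2 divide_right_mono) auto
    also have "\<dots> = \<phi> x * w a powr (2 * \<alpha> - 1) * x powr (1 - 2 * \<alpha>)"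
      using wa \<open>x > 0\<close> powr_minus_divide[of x "2 * \<alpha> - 1"] by (simp add: powr_divide)
    finally have "((\<phi> x)\<^sup>2) powr \<alpha> \<le> \<phi> x * w a powr (2 * \<alpha> - 1) * x powr (1 - 2 * \<alpha>)" .
    then have "2 * x * (K * ((\<phi> x)\<^sup>2) powr \<alpha>)
        \<le> 2 * x * (K * (\<phi> x * w a powr (2 * \<alpha> - 1) * x powr (1 - 2 * \<alpha>)))"
      using \<open>x > 0\<close> \<open>K \<ge> 0\<close> by (intro mult_left_mono) auto
    also have "\<dots> = k * x powr (1 - 2 * \<alpha>) * w x"
      by (simp add: k_def w_def)
    finally have 1: "2 * x * (K * ((\<phi> x)\<^sup>2) powr \<alpha>) \<le> k * x powr (1 - 2 * \<alpha>) * w x" .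
    have "2 * x * (- G (y x)) \<le> 2 * x * (K * ((\<phi> x)\<^sup>2) powr \<alpha>)"
      using Gbound[OF y[of x]] \<open>x > 0\<close> unfolding y\<phi> by (intro mult_left_mono) auto
    from order_trans[OF this 1] show ?thesis by simp
  qed
  define c where "c = w a * exp (A a)"
  have "c > 0" using wa by (simp add: c_def)
  have wc: "w x \<ge> c" if "x \<ge> a" for x
  proof -
    have "A x \<le> 0"
      using \<open>k \<ge> 0\<close> \<open>\<alpha> > 1\<close> by (simp add: A_def)
    then have "c \<le> w a * exp (A a - A x)"
      using wa by (simp add: c_def)
    also have "\<dots> \<le> w x"
      using sublinear_decay_bounded_below[OF der derA decay wa that] by simp
    finally show ?thesis .
  qed
  have pc: "p x \<ge> c / x" if "x \<ge> a" for x
  proof -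
    have "x > 0" using that \<open>a > 0\<close> by simp
    then have "c / x \<le> \<phi> x"
      using wc[OF that] by (simp add: w_def field_simps)
    moreover have "c / x > 0" using \<open>c > 0\<close> \<open>x > 0\<close> by simp
    ultimately have "p x / sqrt (1 + (p x)\<^sup>2) > 0" by (simp add: \<phi>_def)
    then have "p x > 0" using sq(1)[of x] by (simp add: zero_less_divide_iff)
    then have "\<phi> x \<le> p x"
      using sq[of x] mult_left_mono[OF sq(2)[of x], of "p x"]
      by (simp add: \<phi>_def divide_le_eq)
    with \<open>c / x \<le> \<phi> x\<close> show ?thesis by simp
  qed
  show thesis
  proof (rule that[OF \<open>c > 0\<close>])
    fix x assume "x \<ge> a"
    then have "f a - c * ln a \<le> f x - c * ln x"
    proof (rule DERIV_nonneg_imp_nondecreasing)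
      fix t assume "a \<le> t" "t \<le> x"
      then have "((\<lambda>x. f x - c * ln x) has_real_derivative p t - c / t) (at t)"
        using \<open>a > 0\<close> by (auto intro!: derivative_eq_intros derf)
      then show "\<exists>d. ((\<lambda>x. f x - c * ln x) has_real_derivative d) (at t) \<and> 0 \<le> d"
        using pc[OF \<open>a \<le> t\<close>] by (intro exI[of _ "p t - c / t"]) auto
    qed
    then show "f x \<ge> f a + c * ln (x / a)"
      using \<open>x \<ge> a\<close> \<open>a > 0\<close> by (simp add: ln_div algebra_simps)
  qed
qed

section \<open>The ends of a catenoid\<close>

text \<open>The surface is vertical along the waist, so only the open end, where \<open>\<sigma> z > 0\<close>, is a graph chart. It is
  relatively open in the surface, hence the curvature equation can be read off in this chart.\<close>

lemma rotational_end_unbounded: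
  assumes "\<alpha> > 1" "F \<in> frakC1" and \<sigma>: "\<bar>\<sigma>\<bar> = 1" and "r > 0"
    and surf: "embedded_H_surface F \<Sigma> \<eta>" and rot: "rotationally_symmetric \<Sigma>"
    and C2: "C2_on {q. norm q > r} u" and cont: "continuous_on {q. norm q \<ge> r} u"
    and bdry: "\<And>q. norm q = r \<Longrightarrow> u q = 0"
    and sgn: "\<And>q. norm q > r \<Longrightarrow> \<sigma> * u q > 0"
    and part: "{p \<in> \<Sigma>. \<sigma> * p $ 3 \<ge> 0} = graph_over {q. norm q \<ge> r} u"
    and normal: "\<And>p. p \<in> \<Sigma> \<Longrightarrow> \<sigma> * p $ 3 > 0 \<Longrightarrow> \<sigma> * (\<eta> p \<bullet> e3) > 0"
    and lim: "((\<lambda>y. F (\<sigma> * y) / H_alpha \<alpha> (\<sigma> * y)) \<longlongrightarrow> C) (at_left 1)"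
  shows "\<not> bounded ((\<lambda>x. u (x, 0)) ` {r<..})"
proof -
  define U :: "(real \<times> real) set" where "U = {q. norm q > r}"
  have "open U"
    unfolding U_def by (intro open_Collect_less continuous_intros)
  have inS: "graph_map u q \<in> \<Sigma>" if "norm q \<ge> r" for q
    using part that unfolding graph_over_eq_image by blast
  have "graph_map u ` U = {p \<in> \<Sigma>. \<sigma> * p $ 3 > 0}"
  proof (intro equalityI subsetI)
    fix p assume "p \<in> graph_map u ` U"
    then show "p \<in> {p \<in> \<Sigma>. \<sigma> * p $ 3 > 0}"
      using sgn inS by (auto simp: U_def)
  next
    fix p assume p: "p \<in> {p \<in> \<Sigma>. \<sigma> * p $ 3 > 0}"
    then have "p \<in> graph_over {q. norm q \<ge> r} u"
      unfolding part[symmetric] by auto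
    then obtain q where q: "norm q \<ge> r" "p = graph_map u q"
      unfolding graph_over_eq_image by blast
    then have "norm q \<noteq> r"
      using p bdry[of q] by auto
    then show "p \<in> graph_map u ` U"
      using q by (auto simp: U_def)
  qed
  moreover have "open {p :: real^3. \<sigma> * p $ 3 > 0}"
    by (intro open_Collect_less continuous_intros)
  ultimately have "openin (top_of_set \<Sigma>) (graph_map u ` U)"
    by (auto simp: openin_open)
  then have chart: "local_parametrization \<Sigma> U (graph_map u)"
    using \<open>open U\<close> C2 unfolding U_def by (intro local_parametrization_graph_map)
  have rot_u: "u (cos \<theta> * x - sin \<theta> * y, sin \<theta> * x + cos \<theta> * y) = u (x, y)"
    if "norm (x, y) > r" for \<theta> x y
  proof -
    define p where "p = rot_z \<theta> (graph_map u (x, y))"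
    have "p \<in> \<Sigma>"
      using rot inS[of "(x, y)"] that unfolding rotationally_symmetric_def p_def by force
    moreover have "\<sigma> * p $ 3 \<ge> 0"
      using sgn[OF that] by (simp add: p_def rot_z_def)
    ultimately obtain q where q: "p = graph_map u q"
      using part unfolding graph_over_eq_image by blast
    have "fst q = p $ 1" "snd q = p $ 2" "u q = p $ 3"
      by (simp_all add: q)
    then have "q = (cos \<theta> * x - sin \<theta> * y, sin \<theta> * x + cos \<theta> * y)" "u q = u (x, y)"
      by (simp_all add: p_def rot_z_def prod_eq_iff)
    then show ?thesis by simp
  qed
  have N: "norm (\<eta> (graph_map u q)) = 1"
      "\<eta> (graph_map u q) \<bullet> frechet_derivative (graph_map u) (at q) w = 0"
      "\<sigma> * (\<eta> (graph_map u q) \<bullet> e3) > 0"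
      "has_mean_curvature (graph_map u) (\<eta> (graph_map u q)) q (F (\<eta> (graph_map u q) \<bullet> e3))"
    if "norm q > r" for q w
  proof -
    have "q \<in> U" using that by (simp add: U_def)
    then show "\<eta> (graph_map u q) \<bullet> frechet_derivative (graph_map u) (at q) w = 0"
      "has_mean_curvature (graph_map u) (\<eta> (graph_map u q)) q (F (\<eta> (graph_map u q) \<bullet> e3))"
      using surf chart unfolding embedded_H_surface_def unit_normal_def by blast+
    show "norm (\<eta> (graph_map u q)) = 1" "\<sigma> * (\<eta> (graph_map u q) \<bullet> e3) > 0"
      using surf inS[of q] normal[of "graph_map u q"] sgn[of q] that
      unfolding embedded_H_surface_def unit_normal_def by auto
  qed
  obtain p p' where
    du: "\<And>x. x > r \<Longrightarrow> ((\<lambda>x. u (x, 0)) has_real_derivative p x) (at x)" and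
    dp: "\<And>x. x > r \<Longrightarrow> (p has_real_derivative p' x) (at x)" and
    ode: "\<And>x. x > r \<Longrightarrow> 2 * F (\<sigma> / sqrt (1 + (p x)\<^sup>2)) =
        \<sigma> * (p' x / sqrt (1 + (p x)\<^sup>2) ^ 3 + p x / x / sqrt (1 + (p x)\<^sup>2))"
    using rotational_graph_profile[OF C2 \<open>r > 0\<close> rot_u N(1,2) \<sigma> N(3,4)] by blast
  define f where "f x = \<sigma> * u (x, 0)" for x
  have \<sigma>2: "\<sigma>\<^sup>2 = 1"
    using \<sigma> by (metis power2_abs power_one)
  have df: "(f has_real_derivative \<sigma> * p x) (at x)" if "x > r" for x
    unfolding f_def by (intro DERIV_cmult du that)
  have "continuous_on {r..r + 1} f"
    unfolding f_def using \<open>r > 0\<close>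
    by (intro continuous_intros continuous_on_compose2[OF cont]) (auto simp: norm_Pair)
  then obtain l a where a: "r < a" "a < r + 1" "(f has_real_derivative l) (at a)"
      "f (r + 1) - f r = (r + 1 - r) * l"
    using MVT[of r "r + 1" f] df by (auto simp: real_differentiable_def)
  moreover have "f (r + 1) > 0" "f r = 0"
    using sgn[of "(r + 1, 0)"] bdry[of "(r, 0)"] \<open>r > 0\<close> by (auto simp: f_def norm_Pair)
  ultimately have pa: "\<sigma> * p a > 0"
    using DERIV_unique[OF df a(3)] by simp
  have "continuous_on {-1..1} F" and F01: "F (-1) = 0" "F 1 = 0"
    and Fneg: "\<And>y. y \<in> {-1<..<1} \<Longrightarrow> F y < 0"
    using \<open>F \<in> frakC1\<close> unfolding frakC1_def
    by (auto simp: continuous_on_eq_continuous_within intro: DERIV_continuous)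
  have \<sigma>_cases: "\<sigma> = 1 \<or> \<sigma> = -1"
    using \<sigma> by linarith
  have "continuous_on {0..1} (\<lambda>y. F (\<sigma> * y))"
    using \<sigma>_cases
    by (intro continuous_on_compose2[OF \<open>continuous_on {-1..1} F\<close>] continuous_intros) auto
  moreover have "F (\<sigma> * 1) = 0"
    using \<sigma>_cases F01 by auto
  moreover have "H_alpha \<alpha> (\<sigma> * y) = H_alpha \<alpha> y" for y
    by (simp add: H_alpha_def power_mult_distrib \<sigma>2)
  ultimately obtain K where K: "K \<ge> 0"
      "\<And>y. y \<in> {0..1} \<Longrightarrow> \<bar>F (\<sigma> * y)\<bar> \<le> K * (1 - y\<^sup>2) powr \<alpha>"
    using bound_by_H_alpha[of "\<lambda>y. F (\<sigma> * y)" \<alpha> C] lim by auto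
  have Fnonpos: "F (\<sigma> * y) \<le> 0" if "y \<in> {0<..1}" for y
    using \<sigma>_cases F01 Fneg[of "\<sigma> * y"] that by (cases "y = 1") auto
  obtain c where c: "c > 0" "\<And>x. x \<ge> a \<Longrightarrow> f x \<ge> f a + c * ln (x / a)"
  proof (rule profile_log_growth[where G = "\<lambda>y. F (\<sigma> * y)" and f = f and p = "\<lambda>x. \<sigma> * p x"
        and p' = "\<lambda>x. \<sigma> * p' x", OF \<open>\<alpha> > 1\<close> _ \<open>K \<ge> 0\<close> df DERIV_cmult[OF dp] pa])
    show "2 * F (\<sigma> * (1 / sqrt (1 + (\<sigma> * p x)\<^sup>2))) =
        \<sigma> * p' x / sqrt (1 + (\<sigma> * p x)\<^sup>2) ^ 3 + \<sigma> * p x / x / sqrt (1 + (\<sigma> * p x)\<^sup>2)"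
      if "x \<ge> a" for x
      using ode[of x] that a(1) by (simp add: power_mult_distrib \<sigma>2 algebra_simps)
    show "- F (\<sigma> * y) \<le> K * (1 - y\<^sup>2) powr \<alpha>" if "y \<in> {0<..1}" for y
      using K(2)[of y] that by auto
  qed (use a(1) \<open>r > 0\<close> Fnonpos that in auto)
  show ?thesis
  proof
    assume "bounded ((\<lambda>x. u (x, 0)) ` {r<..})"
    then obtain B where B: "B > 0" "\<And>x. x > r \<Longrightarrow> \<bar>u (x, 0)\<bar> \<le> B"
      unfolding bounded_pos by auto
    define x where "x = a * exp ((B + \<bar>f a\<bar> + 1) / c)"
    have "a > 0" using a(1) \<open>r > 0\<close> by simp
    then have "x \<ge> a"
      using B(1) c(1) by (simp add: x_def)
    have "ln (x / a) = (B + \<bar>f a\<bar> + 1) / c"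
      using \<open>a > 0\<close> by (simp add: x_def)
    then have "f x \<ge> f a + (B + \<bar>f a\<bar> + 1)"
      using c(2)[OF \<open>x \<ge> a\<close>] c(1) by simp
    moreover have "f x \<le> B"
    proof -
      have "f x \<le> \<bar>u (x, 0)\<bar>"
        using \<sigma>_cases by (auto simp: f_def)
      also have "\<dots> \<le> B" using B(2)[of x] \<open>x \<ge> a\<close> a(1) by simp
      finally show ?thesis .
    qed
    ultimately show False by linarith
  qed
qed

lemma the_height_graph_over:
  assumes "(x, 0) \<in> S"
  shows "(THE z. vector [x, 0, z] \<in> graph_over S u) = u (x, 0)"
proof -
  have "vector [x, 0, z] \<in> graph_over S u \<longleftrightarrow> z = u (x, 0)" for z
    using assms by (auto simp: graph_over_def vec_eq_iff forall_3)
  then show ?thesis by simp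
qed

lemma H_catenoid_unbounded_upper_height:
  assumes "\<alpha> > 1" "F \<in> frakC1" "sim_at_1 F (H_alpha \<alpha>)" "r > 0" "H_catenoid F r \<Sigma>"
  shows "unbounded_upper_height r \<Sigma>"
proof -
  obtain \<eta> u where cat: "embedded_H_surface F \<Sigma> \<eta>" "rotationally_symmetric \<Sigma>"
      "\<forall>p\<in>upper_part \<Sigma> - waist r. \<eta> p \<bullet> e3 > 0"
    and u: "C2_on {q. norm q > r} u" "continuous_on {q. norm q \<ge> r} u"
      "\<forall>q. norm q = r \<longrightarrow> u q = 0" "\<forall>q. norm q > r \<longrightarrow> u q > 0"
      "upper_part \<Sigma> = graph_over {q. norm q \<ge> r} u"
    using assms(5) unfolding H_catenoid_def bigraph_over_exterior_def by metis
  obtain C where "((\<lambda>y. F y / H_alpha \<alpha> y) \<longlongrightarrow> C) (at_left 1)"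
    using assms(3) unfolding sim_at_1_def by blast
  moreover have "\<eta> p \<bullet> e3 > 0" if "p \<in> \<Sigma>" "p $ 3 > 0" for p
    using cat(3) that by (auto simp: upper_part_def waist_def)
  moreover have "{p \<in> \<Sigma>. 1 * p $ 3 \<ge> 0} = graph_over {q. norm q \<ge> r} u"
    using u(5) by (simp add: upper_part_def)
  ultimately have "\<not> bounded ((\<lambda>x. u (x, 0)) ` {r<..})"
    using u(3,4)
    by (intro rotational_end_unbounded[OF assms(1,2) _ \<open>r > 0\<close> cat(1,2) u(1,2), where \<sigma> = 1]) auto
  moreover have "upper_height \<Sigma> x = u (x, 0)" if "x > r" for x
    unfolding upper_height_def u(5) using that \<open>r > 0\<close>
    by (intro the_height_graph_over) (simp add: norm_Pair)
  ultimately show ?thesis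
    unfolding unbounded_upper_height_def by (metis (no_types, lifting) greaterThan_iff image_cong)
qed

text \<open>On the lower end the normal points downwards, so the profile equation samples \<open>F\<close> at \<open>- 1 / W\<close>:
  the behaviour at \<open>-1\<close> is transported to \<open>1\<close> by \<open>y \<mapsto> - y\<close>.\<close>

lemma H_catenoid_unbounded_lower_height:
  assumes "\<alpha> > 1" "F \<in> frakC1" "sim_at_m1 F (H_alpha \<alpha>)" "r > 0" "H_catenoid F r \<Sigma>"
  shows "unbounded_lower_height r \<Sigma>"
proof -
  obtain \<eta> u where cat: "embedded_H_surface F \<Sigma> \<eta>" "rotationally_symmetric \<Sigma>"
      "\<forall>p\<in>lower_part \<Sigma> - waist r. \<eta> p \<bullet> e3 < 0"
    and u: "C2_on {q. norm q > r} u" "continuous_on {q. norm q \<ge> r} u"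
      "\<forall>q. norm q = r \<longrightarrow> u q = 0" "\<forall>q. norm q > r \<longrightarrow> u q < 0"
      "lower_part \<Sigma> = graph_over {q. norm q \<ge> r} u"
    using assms(5) unfolding H_catenoid_def bigraph_over_exterior_def by metis
  obtain C where "((\<lambda>y. F y / H_alpha \<alpha> y) \<longlongrightarrow> C) (at_right (-1))"
    using assms(3) unfolding sim_at_m1_def by blast
  then have "((\<lambda>y. F (- y) / H_alpha \<alpha> (- y)) \<longlongrightarrow> C) (at_left 1)"
    by (simp add: at_right_minus filterlim_filtermap)
  moreover have "\<eta> p \<bullet> e3 < 0" if "p \<in> \<Sigma>" "p $ 3 < 0" for p
    using cat(3) that by (auto simp: lower_part_def waist_def)
  moreover have "{p \<in> \<Sigma>. (-1) * p $ 3 \<ge> 0} = graph_over {q. norm q \<ge> r} u"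
    using u(5) by (simp add: lower_part_def)
  ultimately have "\<not> bounded ((\<lambda>x. u (x, 0)) ` {r<..})"
    using u(3,4)
    by (intro rotational_end_unbounded[OF assms(1,2) _ \<open>r > 0\<close> cat(1,2) u(1,2), where \<sigma> = "-1"]) auto
  moreover have "lower_height \<Sigma> x = u (x, 0)" if "x > r" for x
    unfolding lower_height_def u(5) using that \<open>r > 0\<close>
    by (intro the_height_graph_over) (simp add: norm_Pair)
  ultimately show ?thesis
    unfolding unbounded_lower_height_def by (metis (no_types, lifting) greaterThan_iff image_cong)
qed

theorem theorem4p1:
  fixes \<alpha> :: real and F :: "real \<Rightarrow> real"
  assumes "\<alpha> > 1" and "F \<in> frakC1"
  shows "(sim_at_1 F (H_alpha \<alpha>) \<longrightarrow>
           (\<forall>r>0. \<forall>\<Sigma>. H_catenoid F r \<Sigma> \<longrightarrow> unbounded_upper_height r \<Sigma>)) \<and>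
         (sim_at_m1 F (H_alpha \<alpha>) \<longrightarrow>
           (\<forall>r>0. \<forall>\<Sigma>. H_catenoid F r \<Sigma> \<longrightarrow> unbounded_lower_height r \<Sigma>)) \<and>
         (sim_both F (H_alpha \<alpha>) \<longrightarrow>
           (\<forall>r>0. \<forall>\<Sigma>. H_catenoid F r \<Sigma> \<longrightarrow>
              unbounded_upper_height r \<Sigma> \<and> unbounded_lower_height r \<Sigma>))"
  unfolding sim_both_def
  using assms H_catenoid_unbounded_upper_height H_catenoid_unbounded_lower_height by blast

end
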